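(* Let $\mathbb{F}$ be a field of characteristic $0$, let $A\neq 0$ be an abelian group, and let $\partial: A\to\mathbb{F}$ be an additive map with $\partial(x)\ne 0$ for all $x\ne 0$. Then $$\mathfrak{aut}(\mathcal{D}_1)\cong X(A)\,\mathfrak{a}\,\mathfrak{c}\rtimes\mathcal{E},$$ where $X(A)$ is identified with the subgroup $N=\{\theta(\chi,1,0,0,1)\mid\chi\in X(A)\}$ of $\mathfrak{aut}(\mathcal{D}_1)$, $X(A)\mathfrak{a}\mathfrak{c}$ denotes the normal subgroup $N\mathfrak{a}\mathfrak{c}$, and $\mathcal{E}$ is identified with the subgroup $\{\theta(1,\varepsilon,0,0,1)\mid\varepsilon\in\mathcal{E}\}$.
   Context: Setting: $\mathbb{F}$ is a field of characteristic $0$, $\mathbb{F}^*=\mathbb{F}\setminus\{0\}$, $A\ne 0$ is an abelian group, $T=\mathbb{F}\partial$ is a one-dimensional vector space, and $\varphi:T\times A\to\mathbb{F}$ is a pairing, $\mathbb{F}$-linear in the first variable and additive in the second; write $\partial(x)=\varphi(\partial,x)$. The pairing is nondegenerate, i.e. $\partial(x)=0$ implies $x=0$. The Lie algebra $\mathcal{D}_1$ is the $\mathbb{F}$-vector space with basis $\{t^x\partial,\ t^x \mid x\in A\}$ and brackets, for $x,y\in A$, $$[t^x\partial,t^y\partial]=\partial(y-x)\,t^{x+y}\partial,\qquad [t^x\partial,t^y]=\partial(y)\,t^{x+y},\qquad [t^x,t^y]=0.$$ $X(A)$ is the group of characters of $A$, i.e. group homomorphisms $A\to\mathbb{F}^*$.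 Since $\partial$ is injective, $A$ is identified with the additive subgroup $\partial(A)\subset\mathbb{F}$; for $\varepsilon\in\mathbb{F}^*$ and $x\in A$, $\varepsilon x$ denotes the product in $\mathbb{F}$ under this identification (when $\varepsilon\partial(x)\in\partial(A)$, it is the unique $y\in A$ with $\partial(y)=\varepsilon\partial(x)$). Put $\mathcal{E}=\{\varepsilon\in\mathbb{F}^*\mid \mathrm{Span}_{\mathbb{F}}\{t^{\varepsilon x}: x\in A\}=\mathrm{Span}_{\mathbb{F}}\{t^x: x\in A\}\}$, i.e. $\mathcal{E}=\{\varepsilon\in\mathbb{F}^*\mid \varepsilon\,\partial(A)=\partial(A)\}$, a group under multiplication. For $\chi\in X(A)$, $\varepsilon\in\mathcal{E}$, $a,b\in\mathbb{F}$, $c\in\mathbb{F}^*$, $\theta(\chi,\varepsilon,a,b,c):\mathcal{D}_1\to\mathcal{D}_1$ is the linear map (a Lie algebra automorphism) with, for all $x,y\in A$, $$\theta(t^x\partial)=\varepsilon^{-1}\chi(x)t^{\varepsilon x}\partial+(b\,\partial(x)+a)\chi(x)t^{\varepsilon x},\qquad \theta(t^y)=c\,\chi(y)t^{\varepsilon y}.$$ $\mathfrak{aut}(\mathcal{D}_1)$ is the group (under composition) of all $\theta(\chi,\varepsilon,a,b,c)$ with $\chi\in X(A)$, $\varepsilon\in\mathcal{E}$, $a,b\in\mathbb{F}$, $c\in\mathbb{F}^*$. In it, put $\mathfrak{a}=\{\theta(1,1,a,b,1)\mid a,b\in\mathbb{F}\}$ and $\mathfrak{c}=\{\theta(1,1,0,0,c)\mid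 c\in\mathbb{F}^*\}$, where the first entry $1$ is the trivial character. *)

theory Defs
  imports Complex_Main "HOL-Algebra.Coset" "HOL-Algebra.Bij" "HOL-Library.Poly_Mapping"
begin

text \<open>
  Throughout, \<open>d :: 'a \<Rightarrow> 'f\<close> is the map \<open>x \<mapsto> \<phi>(\<partial>, x)\<close> from the abelian group \<open>A\<close>, the type
  \<open>'a\<close>, to the field \<open>F\<close>, the type \<open>'f\<close>. The basis vector \<open>t\<^sup>x\<partial>\<close> is indexed by \<open>TD x\<close>, and
  \<open>t\<^sup>x\<close> by \<open>T x\<close>.
\<close>

datatype 'a D1_basis = TD 'a | T 'a

type_synonym ('a, 'f) D1 = "'a D1_basis \<Rightarrow>\<^sub>0 'f"

definition D1_scale :: "'f::field \<Rightarrow> ('a, 'f) D1 \<Rightarrow> ('a, 'f) D1"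
  where "D1_scale r v = Poly_Mapping.map ((*) r) v"

definition vTD :: "'a \<Rightarrow> ('a, 'f::field) D1"
  where "vTD x = Poly_Mapping.single (TD x) 1"

definition vT :: "'a \<Rightarrow> ('a, 'f::field) D1"
  where "vT x = Poly_Mapping.single (T x) 1"

definition D1_extend :: "('a D1_basis \<Rightarrow> ('a, 'f::field) D1) \<Rightarrow> ('a, 'f) D1 \<Rightarrow> ('a, 'f) D1"
  where "D1_extend g v =
    (\<Sum>k\<in>Poly_Mapping.keys v. D1_scale (Poly_Mapping.lookup v k) (g k))"

lemma lookup_D1_scale [simp]:
  "Poly_Mapping.lookup (D1_scale r v) k = r * Poly_Mapping.lookup v k"
  by (simp add: D1_scale_def map.rep_eq "when_def")

interpretation D1: vector_space "D1_scale :: 'f::field \<Rightarrow> ('a, 'f) D1 \<Rightarrow> ('a, 'f) D1"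
  by unfold_locales (auto intro!: poly_mapping_eqI simp: lookup_add algebra_simps)

lemma D1_extend_superset:
  assumes "finite S" "Poly_Mapping.keys v \<subseteq> S"
  shows "D1_extend g v = (\<Sum>k\<in>S. D1_scale (Poly_Mapping.lookup v k) (g k))"
  unfolding D1_extend_def
  by (rule sum.mono_neutral_left) (use assms in \<open>auto simp: in_keys_iff\<close>)

lemma D1_extend_add [simp]: "D1_extend g (v + w) = D1_extend g v + D1_extend g w"
proof -
  let ?S = "Poly_Mapping.keys v \<union> Poly_Mapping.keys w"
  have "Poly_Mapping.keys (v + w) \<subseteq> ?S" by (rule keys_add)
  then show ?thesis
    by (simp add: D1_extend_superset[of ?S] lookup_add D1.scale_left_distrib sum.distrib)
qed

lemma D1_extend_scale [simp]: "D1_extend g (D1_scale r v) = D1_scale r (D1_extend g v)"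
proof -
  have "Poly_Mapping.keys (D1_scale r v) \<subseteq> Poly_Mapping.keys v"
    by (auto simp: in_keys_iff)
  then show ?thesis
    by (simp add: D1_extend_superset[of "Poly_Mapping.keys v"] D1.scale_sum_right)
qed

lemma D1_extend_td [simp]: "D1_extend g (vTD x) = g (TD x)"
  and D1_extend_t [simp]: "D1_extend g (vT x) = g (T x)"
  by (simp_all add: D1_extend_def vTD_def vT_def)

lemma D1_extend_0 [simp]: "D1_extend g 0 = 0"
  by (simp add: D1_extend_def)

lemma D1_extend_add_fun: "D1_extend (\<lambda>k. g k + h k) v = D1_extend g v + D1_extend h v"
  by (simp add: D1_extend_def D1.scale_right_distrib sum.distrib)

lemma D1_extend_scale_fun: "D1_extend (\<lambda>k. D1_scale r (g k)) v = D1_scale r (D1_extend g v)"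
  by (simp add: D1_extend_def D1.scale_sum_right mult.commute)

definition D1_linear :: "(('a, 'f::field) D1 \<Rightarrow> ('a, 'f) D1) \<Rightarrow> bool"
  where "D1_linear f \<longleftrightarrow> module_hom D1_scale D1_scale f"

lemma D1_linearI:
  assumes "\<And>v w. f (v + w) = f v + f w" "\<And>r v. f (D1_scale r v) = D1_scale r (f v)"
  shows "D1_linear f"
  unfolding D1_linear_def by unfold_locales (use assms in \<open>auto simp: algebra_simps\<close>)

lemma D1_linearD:
  assumes "D1_linear f"
  shows "f (v + w) = f v + f w" "f (D1_scale r v) = D1_scale r (f v)" "f 0 = 0"
  using assms unfolding D1_linear_def
  by (auto simp: module_hom.add module_hom.scale module_hom.zero)

lemma D1_linear_extend: "D1_linear (D1_extend g)"
  by (rule D1_linearI) simp_all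

lemma D1_linear_eqI:
  assumes f: "D1_linear f" and g: "D1_linear g"
    and td: "\<And>x. f (vTD x) = g (vTD x)" and t: "\<And>x. f (vT x) = g (vT x)"
  shows "f v = g v"
proof -
  have *: "f (Poly_Mapping.single k r) = g (Poly_Mapping.single k r)" for k r
  proof (cases k)
    case (TD x)
    then have "Poly_Mapping.single k r = D1_scale r (vTD x)"
      by (auto intro!: poly_mapping_eqI simp: vTD_def lookup_single "when_def")
    then show ?thesis by (simp add: D1_linearD(2)[OF f] D1_linearD(2)[OF g] td)
  next
    case (T x)
    then have "Poly_Mapping.single k r = D1_scale r (vT x)"
      by (auto intro!: poly_mapping_eqI simp: vT_def lookup_single "when_def")
    then show ?thesis by (simp add: D1_linearD(2)[OF f] D1_linearD(2)[OF g] t)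
  qed
  show ?thesis
  proof (induction v rule: update_induct)
    case const
    then show ?case by (simp add: D1_linearD(3)[OF f] D1_linearD(3)[OF g])
  next
    case (update p k r)
    have "Poly_Mapping.update k r p = p + Poly_Mapping.single k r"
      using update.hyps
      by (auto intro!: poly_mapping_eqI
          simp: lookup_update lookup_add lookup_single "when_def" in_keys_iff)
    then show ?case
      by (simp add: D1_linearD(1)[OF f] D1_linearD(1)[OF g] update.IH *)
  qed
qed

fun D1_basis_bracket ::
  "('a::ab_group_add \<Rightarrow> 'f::field) \<Rightarrow> 'a D1_basis \<Rightarrow> 'a D1_basis \<Rightarrow> ('a, 'f) D1" where
  "D1_basis_bracket d (TD x) (TD y) = D1_scale (d (y - x)) (vTD (x + y))"
| "D1_basis_bracket d (TD x) (T y) = D1_scale (d y) (vT (x + y))"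
| "D1_basis_bracket d (T y) (TD x) = - D1_scale (d y) (vT (x + y))"
| "D1_basis_bracket d (T x) (T y) = 0"

definition D1_bracket ::
  "('a::ab_group_add \<Rightarrow> 'f::field) \<Rightarrow> ('a, 'f) D1 \<Rightarrow> ('a, 'f) D1 \<Rightarrow> ('a, 'f) D1"
  where "D1_bracket d v w = D1_extend (\<lambda>k. D1_extend (D1_basis_bracket d k) w) v"

definition D1_lie_automorphism ::
  "('a::ab_group_add \<Rightarrow> 'f::field) \<Rightarrow> (('a, 'f) D1 \<Rightarrow> ('a, 'f) D1) \<Rightarrow> bool"
  where "D1_lie_automorphism d f \<longleftrightarrow> D1_linear f \<and> bij f \<and>
    (\<forall>v w. f (D1_bracket d v w) = D1_bracket d (f v) (f w))"

definition characters :: "('a::ab_group_add \<Rightarrow> 'f::field) set"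
  where "characters = {\<chi>. (\<forall>x. \<chi> x \<noteq> 0) \<and> (\<forall>x y. \<chi> (x + y) = \<chi> x * \<chi> y)}"

definition character_group :: "('a::ab_group_add \<Rightarrow> 'f::field) monoid"
  where "character_group = \<lparr>carrier = characters, mult = (\<lambda>\<chi> \<psi> x. \<chi> x * \<psi> x), one = (\<lambda>x. 1)\<rparr>"

definition scalings :: "('a::ab_group_add \<Rightarrow> 'f::field) \<Rightarrow> 'f set"
  where "scalings d = {\<epsilon>. \<epsilon> \<noteq> 0 \<and> (\<lambda>z. \<epsilon> * z) ` range d = range d}"

definition scaling_group :: "('a::ab_group_add \<Rightarrow> 'f::field) \<Rightarrow> 'f monoid"
  where "scaling_group d = \<lparr>carrier = scalings d, mult = (*), one = 1\<rparr>"

text \<open>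
  The element \<open>\<epsilon>x\<close> of \<open>A\<close>, where \<open>A\<close> is identified with \<open>d(A)\<close>; it is meaningful only when
  \<open>d\<close> is injective and \<open>\<epsilon> * d x\<close> lies in the range of \<open>d\<close>.
\<close>

definition group_scale :: "('a::ab_group_add \<Rightarrow> 'f::field) \<Rightarrow> 'f \<Rightarrow> 'a \<Rightarrow> 'a"
  where "group_scale d \<epsilon> x = (THE y. d y = \<epsilon> * d x)"

fun theta_basis ::
  "('a::ab_group_add \<Rightarrow> 'f::field) \<Rightarrow> ('a \<Rightarrow> 'f) \<Rightarrow> 'f \<Rightarrow> 'f \<Rightarrow> 'f \<Rightarrow> 'f \<Rightarrow> 'a D1_basis \<Rightarrow> ('a, 'f) D1"
  where
  "theta_basis d \<chi> \<epsilon> a b c (TD x) =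
     D1_scale (inverse \<epsilon> * \<chi> x) (vTD (group_scale d \<epsilon> x)) +
     D1_scale ((b * d x + a) * \<chi> x) (vT (group_scale d \<epsilon> x))"
| "theta_basis d \<chi> \<epsilon> a b c (T y) = D1_scale (c * \<chi> y) (vT (group_scale d \<epsilon> y))"

definition theta ::
  "('a::ab_group_add \<Rightarrow> 'f::field) \<Rightarrow> ('a \<Rightarrow> 'f) \<Rightarrow> 'f \<Rightarrow> 'f \<Rightarrow> 'f \<Rightarrow> 'f \<Rightarrow> ('a, 'f) D1 \<Rightarrow> ('a, 'f) D1"
  where "theta d \<chi> \<epsilon> a b c = D1_extend (theta_basis d \<chi> \<epsilon> a b c)"

text \<open>
  This is not the group of all Lie algebra automorphisms of \<open>D\<^sub>1\<close>: for \<open>y \<noteq> 0\<close> the automorphism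
  \<open>exp (ad (t\<^sup>y))\<close> is not of the form below. That the elements are indeed Lie algebra
  automorphisms is \<open>aut_D1_lie_automorphism\<close> below.
\<close>

definition aut_D1 :: "('a::ab_group_add \<Rightarrow> 'f::field) \<Rightarrow> (('a, 'f) D1 \<Rightarrow> ('a, 'f) D1) monoid"
  where "aut_D1 d = \<lparr>carrier =
      {theta d \<chi> \<epsilon> a b c | \<chi> \<epsilon> a b c. \<chi> \<in> characters \<and> \<epsilon> \<in> scalings d \<and> c \<noteq> 0},
    mult = (\<circ>), one = id\<rparr>"

definition subgroup_X :: "('a::ab_group_add \<Rightarrow> 'f::field) \<Rightarrow> (('a, 'f) D1 \<Rightarrow> ('a, 'f) D1) set"
  where "subgroup_X d = {theta d \<chi> 1 0 0 1 | \<chi>. \<chi> \<in> characters}"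

definition subgroup_a :: "('a::ab_group_add \<Rightarrow> 'f::field) \<Rightarrow> (('a, 'f) D1 \<Rightarrow> ('a, 'f) D1) set"
  where "subgroup_a d = {theta d (\<lambda>x. 1) 1 a b 1 | a b. True}"

definition subgroup_c :: "('a::ab_group_add \<Rightarrow> 'f::field) \<Rightarrow> (('a, 'f) D1 \<Rightarrow> ('a, 'f) D1) set"
  where "subgroup_c d = {theta d (\<lambda>x. 1) 1 0 0 c | c. c \<noteq> 0}"

definition subgroup_E :: "('a::ab_group_add \<Rightarrow> 'f::field) \<Rightarrow> (('a, 'f) D1 \<Rightarrow> ('a, 'f) D1) set"
  where "subgroup_E d = {theta d (\<lambda>x. 1) \<epsilon> 0 0 1 | \<epsilon>. \<epsilon> \<in> scalings d}"

definition subgroup_Xac :: "('a::ab_group_add \<Rightarrow> 'f::field) \<Rightarrow> (('a, 'f) D1 \<Rightarrow> ('a, 'f) D1) set"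
  where "subgroup_Xac d =
    subgroup_X d <#>\<^bsub>aut_D1 d\<^esub> subgroup_a d <#>\<^bsub>aut_D1 d\<^esub> subgroup_c d"

text \<open>
  The external semidirect product of \<open>N\<close> and \<open>H\<close> with respect to an action of \<open>H\<close> on \<open>N\<close>; it is
  meaningful for \<open>\<alpha> \<in> hom H (AutoGroup N)\<close>.
\<close>

definition semidirect_product ::
  "('n, 'p) monoid_scheme \<Rightarrow> ('h, 'q) monoid_scheme \<Rightarrow> ('h \<Rightarrow> 'n \<Rightarrow> 'n) \<Rightarrow> ('n \<times> 'h) monoid"
  where "semidirect_product N H \<alpha> =
    \<lparr>carrier = carrier N \<times> carrier H,
     mult = (\<lambda>(n, h) (n', h'). (n \<otimes>\<^bsub>N\<^esub> \<alpha> h n', h \<otimes>\<^bsub>H\<^esub> h')),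
     one = (\<one>\<^bsub>N\<^esub>, \<one>\<^bsub>H\<^esub>)\<rparr>"

text \<open>
  The action of \<open>G\<close> on a normal subgroup \<open>N\<close> by conjugation, restricted to \<open>N\<close> because \<open>AutoGroup\<close> consists of extensional functions.
\<close>

definition conjugation_action :: "('g, 'm) monoid_scheme \<Rightarrow> 'g set \<Rightarrow> 'g \<Rightarrow> 'g \<Rightarrow> 'g"
  where "conjugation_action G N h = (\<lambda>n\<in>N. h \<otimes>\<^bsub>G\<^esub> n \<otimes>\<^bsub>G\<^esub> inv\<^bsub>G\<^esub> h)"

lemma D1_bracket_basis [simp]:
  "D1_bracket d (vTD x) (vTD y) = D1_scale (d (y - x)) (vTD (x + y))"
  "D1_bracket d (vTD x) (vT y) = D1_scale (d y) (vT (x + y))"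
  "D1_bracket d (vT y) (vTD x) = - D1_scale (d y) (vT (x + y))"
  "D1_bracket d (vT x) (vT y) = 0"
  by (simp_all add: D1_bracket_def)

lemma D1_bracket_add_left: "D1_bracket d (u + v) w = D1_bracket d u w + D1_bracket d v w"
  and D1_bracket_scale_left: "D1_bracket d (D1_scale r v) w = D1_scale r (D1_bracket d v w)"
  and D1_bracket_add_right: "D1_bracket d w (u + v) = D1_bracket d w u + D1_bracket d w v"
  and D1_bracket_scale_right: "D1_bracket d v (D1_scale r w) = D1_scale r (D1_bracket d v w)"
  by (simp_all add: D1_bracket_def D1_extend_add_fun D1_extend_scale_fun)

lemmas D1_bracket_linear = D1_bracket_add_left D1_bracket_scale_left
  D1_bracket_add_right D1_bracket_scale_right

lemma D1_bracket_minus_left: "D1_bracket d (- v) w = - D1_bracket d v w"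
  using D1_bracket_scale_left[of d "-1" v w] by simp

lemma D1_bracket_minus_right: "D1_bracket d v (- w) = - D1_bracket d v w"
  using D1_bracket_scale_right[of d v "-1" w] by simp

lemma D1_bracket_zero [simp]: "D1_bracket d v 0 = 0"
  using D1_bracket_scale_right[of d v 0 0] by simp

lemmas D1_bracket_minus = D1_bracket_minus_left D1_bracket_minus_right

context
  fixes d :: "'a::ab_group_add \<Rightarrow> 'f::field_char_0"
  assumes additive: "\<And>x y. d (x + y) = d x + d y"
    and nondegenerate: "\<And>x. x \<noteq> 0 \<Longrightarrow> d x \<noteq> 0"
begin

lemma d_diff: "d (x - y) = d x - d y"
  using additive[of "x - y" y] by simp

lemma d_eq_iff: "d x = d y \<longleftrightarrow> x = y"
  using nondegenerate[of "x - y"] by (auto simp: d_diff)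

lemma D1_bracket_skew: "D1_bracket d v w = - D1_bracket d w v"
proof -
  have lin1: "D1_linear (\<lambda>v. D1_bracket d v w)" "D1_linear (\<lambda>v. - D1_bracket d w v)" for w
    by (rule D1_linearI; simp add: D1_bracket_linear)+
  have lin2: "D1_linear (\<lambda>w. D1_bracket d v w)" "D1_linear (\<lambda>w. - D1_bracket d w v)" for v
    by (rule D1_linearI; simp add: D1_bracket_linear)+
  have td: "D1_bracket d (vTD x) w = - D1_bracket d w (vTD x)" for x w
    by (rule D1_linear_eqI[OF lin2])
      (auto simp: D1.scale_left_diff_distrib d_diff add.commute)
  have t: "D1_bracket d (vT x) w = - D1_bracket d w (vT x)" for x w
    by (rule D1_linear_eqI[OF lin2]) auto
  show ?thesis by (rule D1_linear_eqI[OF lin1]) (rule td t)+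
qed

lemma D1_bracket_self: "D1_bracket d v v = 0"
proof -
  have "D1_bracket d v v + D1_bracket d v v = 0"
    by (metis D1_bracket_skew add.right_inverse)
  then have "Poly_Mapping.lookup (D1_bracket d v v) k + Poly_Mapping.lookup (D1_bracket d v v) k = 0"
    for k by (metis lookup_add lookup_zero)
  then show ?thesis by (intro poly_mapping_eqI) (simp add: mult_2[symmetric])
qed

lemma D1_jacobi:
  "D1_bracket d u (D1_bracket d v w) + D1_bracket d v (D1_bracket d w u)
     + D1_bracket d w (D1_bracket d u v) = 0"
proof -
  let ?J = "\<lambda>u v w. D1_bracket d u (D1_bracket d v w) + D1_bracket d v (D1_bracket d w u)
     + D1_bracket d w (D1_bracket d u v)"
  have lin0: "D1_linear (\<lambda>_. 0)" by (rule D1_linearI) auto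
  have lin1: "D1_linear (\<lambda>u. ?J u v w)" for v w
    by (rule D1_linearI) (simp_all add: D1_bracket_linear D1.scale_right_distrib)
  have rot: "?J u v w = ?J v w u" for u v w by (simp add: add_ac)
  have lin2: "D1_linear (\<lambda>v. ?J u v w)" for u w
    by (rule D1_linearI) (simp_all add: D1_bracket_linear D1.scale_right_distrib)
  have lin3: "D1_linear (\<lambda>w. ?J u v w)" for u v
    by (rule D1_linearI) (simp_all add: D1_bracket_linear D1.scale_right_distrib)
  note eval = D1_bracket_linear D1_bracket_minus additive d_diff add_ac
  note coeff = lookup_add lookup_minus lookup_single "when_def" vTD_def vT_def algebra_simps
  have base: "?J (vTD x) (vTD y) (vTD z) = 0" "?J (vTD x) (vTD y) (vT z) = 0"
    "?J (vTD x) (vT y) (vT z) = 0" "?J (vT x) (vT y) (vT z) = 0" for x y z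
    subgoal by (simp add: eval) (auto intro!: poly_mapping_eqI simp: coeff)
    subgoal by (simp add: eval) (auto intro!: poly_mapping_eqI simp: coeff)
    subgoal by (simp add: eval)
    subgoal by (simp add: eval)
    done
  have base': "?J (vTD x) (vT y) (vTD z) = 0" "?J (vT x) (vTD y) (vTD z) = 0" 
    "?J (vT x) (vTD y) (vT z) = 0" "?J (vT x) (vT y) (vTD z) = 0" for x y z
    using base(2)[of z x y] base(2)[of y z x] base(3)[of y z x] base(3)[of z x y] 
    by (simp_all only: add_ac)
  have "?J (vTD x) (vTD y) w = 0" "?J (vTD x) (vT y) w = 0" "?J (vT x) (vTD y) w = 0"
    "?J (vT x) (vT y) w = 0" for x y w
    by (rule D1_linear_eqI[OF lin3 lin0]; rule base base')+
  then have "?J (vTD x) v w = 0" "?J (vT x) v w = 0" for x v w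
    by - (rule D1_linear_eqI[OF lin2 lin0]; assumption)+
  then show ?thesis
    by - (rule D1_linear_eqI[OF lin1 lin0]; assumption)
qed

lemma group_scale:
  assumes "\<epsilon> \<in> scalings d"
  shows "d (group_scale d \<epsilon> x) = \<epsilon> * d x"
proof -
  have "\<epsilon> * d x \<in> range d" using assms by (auto simp: scalings_def)
  then obtain y where "d y = \<epsilon> * d x" by auto
  then show ?thesis unfolding group_scale_def by (rule theI) (auto simp: d_eq_iff[symmetric] \<open>d y = _\<close>)
qed

lemma theta_td: "theta d \<chi> \<epsilon> a b c (vTD x) =
     D1_scale (inverse \<epsilon> * \<chi> x) (vTD (group_scale d \<epsilon> x)) +
     D1_scale ((b * d x + a) * \<chi> x) (vT (group_scale d \<epsilon> x))"
  and theta_t: "theta d \<chi> \<epsilon> a b c (vT y) = D1_scale (c * \<chi> y) (vT (group_scale d \<epsilon> y))"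
  and theta_linear: "D1_linear (theta d \<chi> \<epsilon> a b c)"
  by (simp_all add: theta_def D1_linear_extend)

lemma group_scale_add:
  assumes "\<epsilon> \<in> scalings d"
  shows "group_scale d \<epsilon> (x + y) = group_scale d \<epsilon> x + group_scale d \<epsilon> y"
  by (simp add: d_eq_iff[symmetric] additive group_scale[OF assms] algebra_simps)

lemma scalings_mult:
  assumes "\<epsilon> \<in> scalings d" "\<epsilon>' \<in> scalings d"
  shows "\<epsilon> * \<epsilon>' \<in> scalings d"
proof -
  have "(\<lambda>z. \<epsilon> * \<epsilon>' * z) ` range d = (\<lambda>z. \<epsilon> * z) ` (\<lambda>z. \<epsilon>' * z) ` range d"
    by (simp add: image_image mult.assoc)
  then show ?thesis using assms by (auto simp: scalings_def)
qed

lemma scalings_inverse: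
  assumes "\<epsilon> \<in> scalings d"
  shows "inverse \<epsilon> \<in> scalings d"
proof -
  have "\<epsilon> \<noteq> 0" "(\<lambda>z. \<epsilon> * z) ` range d = range d" using assms by (auto simp: scalings_def)
  then have "(\<lambda>z. inverse \<epsilon> * z) ` range d = (\<lambda>z. inverse \<epsilon> * (\<epsilon> * z)) ` range d"
    by (metis image_image)
  also have "\<dots> = range d" using \<open>\<epsilon> \<noteq> 0\<close> by (simp add: mult.assoc[symmetric])
  finally show ?thesis using \<open>\<epsilon> \<noteq> 0\<close> by (simp add: scalings_def)
qed

lemma group_scale_group_scale:
  assumes "\<epsilon> \<in> scalings d" "\<epsilon>' \<in> scalings d"
  shows "group_scale d \<epsilon> (group_scale d \<epsilon>' x) = group_scale d (\<epsilon> * \<epsilon>') x"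
  by (simp add: d_eq_iff[symmetric] group_scale assms scalings_mult mult.assoc)

lemma group_scale_1 [simp]: "group_scale d 1 x = x"
  by (simp add: d_eq_iff[symmetric] group_scale scalings_def)

lemma theta_1: "theta d (\<lambda>x. 1) 1 0 0 1 = id"
proof
  fix v
  have "D1_linear id" by (rule D1_linearI) auto
  then show "theta d (\<lambda>x. 1) 1 0 0 1 v = id v"
    by (rule D1_linear_eqI[OF theta_linear]) (simp_all add: theta_td theta_t)
qed

lemma theta_comp:
  assumes "\<epsilon> \<in> scalings d" "\<epsilon>' \<in> scalings d"
  shows "theta d \<chi> \<epsilon> a b c \<circ> theta d \<chi>' \<epsilon>' a' b' c' =
    theta d (\<lambda>x. \<chi>' x * \<chi> (group_scale d \<epsilon>' x)) (\<epsilon> * \<epsilon>')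
      (inverse \<epsilon>' * a + c * a') (b + c * b') (c * c')"
proof
  fix v
  have nz: "\<epsilon> \<noteq> 0" "\<epsilon>' \<noteq> 0" using assms by (auto simp: scalings_def)
  have lin: "D1_linear (theta d \<chi> \<epsilon> a b c \<circ> theta d \<chi>' \<epsilon>' a' b' c')"
    by (rule D1_linearI) (simp_all add: D1_linearD[OF theta_linear])
  show "(theta d \<chi> \<epsilon> a b c \<circ> theta d \<chi>' \<epsilon>' a' b' c') v =
    theta d (\<lambda>x. \<chi>' x * \<chi> (group_scale d \<epsilon>' x)) (\<epsilon> * \<epsilon>')
      (inverse \<epsilon>' * a + c * a') (b + c * b') (c * c') v"
    by (rule D1_linear_eqI[OF lin theta_linear])
      (simp_all add: theta_td theta_t D1_linearD[OF theta_linear] group_scale_group_scale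
        group_scale assms,
       use nz in \<open>auto intro!: poly_mapping_eqI
         simp: lookup_add vTD_def vT_def lookup_single "when_def" field_simps\<close>)
qed

lemma theta_right_inverse:
  assumes "\<chi> \<in> characters" "\<epsilon> \<in> scalings d" "c \<noteq> 0"
  shows "\<exists>\<chi>' \<epsilon>' a' b' c'. \<chi>' \<in> characters \<and> \<epsilon>' \<in> scalings d \<and> c' \<noteq> 0 \<and>
    theta d \<chi> \<epsilon> a b c \<circ> theta d \<chi>' \<epsilon>' a' b' c' = id"
proof -
  let ?\<epsilon> = "inverse \<epsilon>" and ?\<chi> = "\<lambda>x. inverse (\<chi> (group_scale d (inverse \<epsilon>) x))"
  have "\<epsilon> \<noteq> 0" using assms by (auto simp: scalings_def)
  then have "theta d \<chi> \<epsilon> a b c \<circ> theta d ?\<chi> ?\<epsilon> (- (\<epsilon> * a / c)) (- (b / c)) (1 / c) = id"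
    using assms by (simp add: theta_comp scalings_inverse theta_1 characters_def)
  moreover have "?\<chi> \<in> characters"
    using assms by (auto simp: characters_def group_scale_add scalings_inverse)
  ultimately show ?thesis
    using assms scalings_inverse[OF assms(2)] by (metis divide_eq_0_iff zero_neq_one)
qed

lemma theta_bij:
  assumes "\<chi> \<in> characters" "\<epsilon> \<in> scalings d" "c \<noteq> 0"
  shows "bij (theta d \<chi> \<epsilon> a b c)"
proof -
  obtain \<chi>' \<epsilon>' a' b' c' where 1: "\<chi>' \<in> characters" "\<epsilon>' \<in> scalings d" "c' \<noteq> 0"
    "theta d \<chi> \<epsilon> a b c \<circ> theta d \<chi>' \<epsilon>' a' b' c' = id"
    using theta_right_inverse[OF assms] by blast
  obtain h where 2: "theta d \<chi>' \<epsilon>' a' b' c' \<circ> h = id"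
    using theta_right_inverse[OF 1(1,2,3)] by blast
  have "theta d \<chi> \<epsilon> a b c = h"
    using 1(4) 2 by (metis comp_assoc comp_id id_comp)
  then show ?thesis using 1(4) 2 o_bij by metis
qed

lemma theta_bracket:
  assumes \<chi>: "\<chi> \<in> characters" and \<epsilon>: "\<epsilon> \<in> scalings d"
  shows "theta d \<chi> \<epsilon> a b c (D1_bracket d v w) =
    D1_bracket d (theta d \<chi> \<epsilon> a b c v) (theta d \<chi> \<epsilon> a b c w)"
proof -
  let ?\<theta> = "theta d \<chi> \<epsilon> a b c"
  have nz: "\<epsilon> \<noteq> 0" using \<epsilon> by (auto simp: scalings_def)
  have mult: "\<chi> (x + y) = \<chi> x * \<chi> y" for x y using \<chi> by (auto simp: characters_def)
  note lin = D1_bracket_linear D1_linearD[OF theta_linear] D1.scale_right_distrib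
  have lin1: "D1_linear (\<lambda>v. ?\<theta> (D1_bracket d v w))"
    "D1_linear (\<lambda>v. D1_bracket d (?\<theta> v) (?\<theta> w))" for w
    by (rule D1_linearI; simp add: lin)+
  have lin2: "D1_linear (\<lambda>w. ?\<theta> (D1_bracket d v w))"
    "D1_linear (\<lambda>w. D1_bracket d (?\<theta> v) (?\<theta> w))" for v
    by (rule D1_linearI; simp add: lin)+
  have minus: "?\<theta> (- v) = - ?\<theta> v" for v
    using D1_linearD(2)[OF theta_linear, of \<chi> \<epsilon> a b c "-1" v] by simp
  note eval = lin D1_bracket_minus minus theta_td theta_t group_scale_add[OF \<epsilon>] additive d_diff
    group_scale[OF \<epsilon>] mult
  note coeff = lookup_add lookup_minus lookup_single "when_def" vTD_def vT_def
  have base: "?\<theta> (D1_bracket d (vTD x) (vTD y)) = D1_bracket d (?\<theta> (vTD x)) (?\<theta> (vTD y))"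
    "?\<theta> (D1_bracket d (vTD x) (vT y)) = D1_bracket d (?\<theta> (vTD x)) (?\<theta> (vT y))" for x y
    using nz
    by (simp_all add: eval) (auto intro!: poly_mapping_eqI simp: coeff field_simps)
  have base': "?\<theta> (D1_bracket d (vT y) (vTD x)) = D1_bracket d (?\<theta> (vT y)) (?\<theta> (vTD x))"
    "?\<theta> (D1_bracket d (vT x) (vT y)) = D1_bracket d (?\<theta> (vT x)) (?\<theta> (vT y))" for x y
    subgoal using base(2)[of x y] by (metis D1_bracket_skew minus)
    subgoal by (simp add: eval)
    done
  have "?\<theta> (D1_bracket d (vTD x) w) = D1_bracket d (?\<theta> (vTD x)) (?\<theta> w)"
    "?\<theta> (D1_bracket d (vT x) w) = D1_bracket d (?\<theta> (vT x)) (?\<theta> w)" for x w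
    by (rule D1_linear_eqI[OF lin2]; rule base base')+
  then show ?thesis
    by - (rule D1_linear_eqI[OF lin1]; assumption)
qed

lemma aut_D1_lie_automorphism:
  assumes "f \<in> carrier (aut_D1 d)"
  shows "D1_lie_automorphism d f"
  using assms
  by (auto simp: aut_D1_def D1_lie_automorphism_def theta_linear theta_bij theta_bracket)

end

end

theory Submission
  imports Defs
begin

text \<open>
  The composition rule \<open>theta_comp\<close> shows that \<open>\<epsilon>\<close> is multiplicative in \<open>\<theta>(\<chi>,\<epsilon>,a,b,c)\<close>, and it is
  determined by the map because some \<open>x\<close> has \<open>\<partial>(x) \<noteq> 0\<close>. So \<open>\<theta> \<mapsto> \<epsilon>\<close> is a homomorphism onto
  \<open>\<E>\<close>; its kernel is \<open>X(A)\<aa>\<cc>\<close>, and \<open>\<epsilon> \<mapsto> \<theta>(1,\<epsilon>,0,0,1)\<close> splits it.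
\<close>

section \<open>Semidirect products from split extensions\<close>

context
  fixes G :: "('g, 'm) monoid_scheme" and E :: "('e, 'k) monoid_scheme"
    and N :: "'g set" and s :: "'e \<Rightarrow> 'g"
  assumes normal: "N \<lhd> G" and E: "group E" and s: "s \<in> hom E G"
begin

interpretation normal N G by (rule normal)
interpretation E: group E by (rule E)

lemma inv_cancel_left:
  assumes "x \<in> carrier G" "y \<in> carrier G"
  shows "inv\<^bsub>G\<^esub> x \<otimes>\<^bsub>G\<^esub> (x \<otimes>\<^bsub>G\<^esub> y) = y"
  using assms by (simp add: m_assoc[symmetric])

section \<open>Conjugation as an action on a normal subgroup\<close>

lemma conjugation_action_closed:
  assumes "g \<in> carrier G" "n \<in> N"
  shows "conjugation_action G N g n \<in> N"
  using assms by (simp add: conjugation_action_def inv_op_closed2)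

lemma conjugation_action_mult:
  assumes "g \<in> carrier G" "h \<in> carrier G" "n \<in> N"
  shows "conjugation_action G N (g \<otimes>\<^bsub>G\<^esub> h) n = conjugation_action G N g (conjugation_action G N h n)"
  using assms conjugation_action_closed[of h n]
  by (simp add: conjugation_action_def inv_mult_group m_assoc)

lemma conjugation_action_one:
  assumes "n \<in> N"
  shows "conjugation_action G N \<one>\<^bsub>G\<^esub> n = n"
  using assms by (simp add: conjugation_action_def)

text \<open>Conjugation by \<open>inv g\<close> undoes conjugation by \<open>g\<close>, and both
  preserve \<open>N\<close> by normality; this gives bijectivity. Multiplicativity is the
  cancellation of \<open>inv g\<close> against \<open>g\<close> between the two conjugates.\<close>

lemma conjugation_action_auto:
  assumes g: "g \<in> carrier G"
  shows "conjugation_action G N g \<in> auto (G\<lparr>carrier := N\<rparr>)"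
proof -
  let ?c = "conjugation_action G N"
  have hom: "?c g \<in> hom (G\<lparr>carrier := N\<rparr>) (G\<lparr>carrier := N\<rparr>)"
  proof (rule homI)
    fix n m assume "n \<in> carrier (G\<lparr>carrier := N\<rparr>)" "m \<in> carrier (G\<lparr>carrier := N\<rparr>)"
    then have nm: "n \<in> N" "m \<in> N" by simp_all
    show "?c g (n \<otimes>\<^bsub>G\<lparr>carrier := N\<rparr>\<^esub> m) = ?c g n \<otimes>\<^bsub>G\<lparr>carrier := N\<rparr>\<^esub> ?c g m"
      using g nm by (simp add: conjugation_action_def m_assoc inv_cancel_left)
  qed (use g in \<open>simp add: conjugation_action_closed\<close>)
  have "bij_betw (?c g) N N"
  proof (rule bij_betw_byWitness[where f' = "?c (inv\<^bsub>G\<^esub> g)"])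
    show "\<forall>n\<in>N. ?c (inv\<^bsub>G\<^esub> g) (?c g n) = n" "\<forall>n\<in>N. ?c g (?c (inv\<^bsub>G\<^esub> g) n) = n"
      using g by (simp_all add: conjugation_action_mult[symmetric] conjugation_action_one)
  qed (use g in \<open>auto simp: conjugation_action_closed\<close>)
  then show ?thesis
    \<comment> \<open>\<open>Bij\<close> also demands extensionality, which holds because the action
      is defined by restriction to \<open>N\<close>.\<close>
    using hom by (simp add: auto_def Bij_def) (simp add: conjugation_action_def)
qed

lemma conjugation_action_hom:
  "(\<lambda>e. conjugation_action G N (s e)) \<in> hom E (AutoGroup (G\<lparr>carrier := N\<rparr>))"
proof (rule homI)
  fix e assume "e \<in> carrier E"
  then show "conjugation_action G N (s e) \<in> carrier (AutoGroup (G\<lparr>carrier := N\<rparr>))"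
    using s by (simp add: AutoGroup_def conjugation_action_auto hom_in_carrier)
next
  fix e e' assume e: "e \<in> carrier E" "e' \<in> carrier E"
  then have c: "s e \<in> carrier G" "s e' \<in> carrier G" using s by (simp_all add: hom_in_carrier)
  \<comment> \<open>The product of \<open>BijGroup\<close> is itself restricted to
    \<open>Bij N\<close>, so it unfolds to \<open>compose\<close> only once membership of both
    factors is known.\<close>
  then have B: "conjugation_action G N (s e) \<in> Bij N" "conjugation_action G N (s e') \<in> Bij N"
    using conjugation_action_auto by (auto simp: auto_def)
  have "conjugation_action G N (s e \<otimes>\<^bsub>G\<^esub> s e') =
    compose N (conjugation_action G N (s e)) (conjugation_action G N (s e'))"
  proof
    fix n
    show "conjugation_action G N (s e \<otimes>\<^bsub>G\<^esub> s e') n =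
      compose N (conjugation_action G N (s e)) (conjugation_action G N (s e')) n"
      \<comment> \<open>Off \<open>N\<close> both sides are \<open>undefined\<close>, by the
        restriction in \<open>conjugation_action\<close> and in \<open>compose\<close>.\<close>
      by (cases "n \<in> N")
        (use c in \<open>simp_all add: compose_def conjugation_action_mult,
          simp add: conjugation_action_def\<close>)
  qed
  then show "conjugation_action G N (s (e \<otimes>\<^bsub>E\<^esub> e')) =
    conjugation_action G N (s e) \<otimes>\<^bsub>AutoGroup (G\<lparr>carrier := N\<rparr>)\<^esub> conjugation_action G N (s e')"
    using B by (simp add: hom_mult[OF s e] AutoGroup_def BijGroup_def)
qed

text \<open>The conjugation built into the product is what makes this work: in
  \<open>n (s e m inv (s e)) (s e s f)\<close> the inner factors cancel and leave
  \<open>(n s e) (m s f)\<close>. Bijectivity is a separate matter, settled for the concrete group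
  later.\<close>

lemma semidirect_product_mult_hom:
  "(\<lambda>(n, e). n \<otimes>\<^bsub>G\<^esub> s e)
    \<in> hom (semidirect_product (G\<lparr>carrier := N\<rparr>) E (\<lambda>e. conjugation_action G N (s e))) G"
proof (rule homI, goal_cases)
  case (1 p)
  then show ?case using s by (auto simp: semidirect_product_def hom_in_carrier)
next
  case (2 p q)
  then obtain n e m f where p: "p = (n, e)" "n \<in> N" "e \<in> carrier E"
    and q: "q = (m, f)" "m \<in> N" "f \<in> carrier E"
    by (auto simp: semidirect_product_def)
  have c: "s e \<in> carrier G" "s f \<in> carrier G" using s p q by (simp_all add: hom_in_carrier)
  then show ?case
    using p q by (simp add: semidirect_product_def conjugation_action_def hom_mult[OF s] m_assoc
        inv_cancel_left)
qed

text \<open>The inverse of a multiplicative bijection is multiplicative: the two elements to be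
  compared have the same image under \<open>f\<close>, and both lie in the carrier because it is
  closed under multiplication. The group axioms of the semidirect product are thereby never verified
  by hand.\<close>

lemma semidirect_product_iso_sym:
  assumes iso: "f \<in> iso (semidirect_product (G\<lparr>carrier := N\<rparr>) E (\<lambda>e. conjugation_action G N (s e))) G"
  shows "G \<cong> semidirect_product (G\<lparr>carrier := N\<rparr>) E (\<lambda>e. conjugation_action G N (s e))"
    (is "_ \<cong> ?S")
proof (rule is_isoI, rule isoI)
  let ?g = "inv_into (carrier ?S) f"
  have f: "f \<in> hom ?S G" and bij: "bij_betw f (carrier ?S) (carrier G)"
    using iso by (auto simp: iso_def)
  show bij': "bij_betw ?g (carrier G) (carrier ?S)" using bij by (rule bij_betw_inv_into)
  have closed: "p \<otimes>\<^bsub>?S\<^esub> q \<in> carrier ?S" if "p \<in> carrier ?S" "q \<in> carrier ?S" for p q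
    using that s by (auto simp: semidirect_product_def hom_in_carrier conjugation_action_closed)
  show "?g \<in> hom G ?S"
  proof (rule homI)
    show in_S: "?g x \<in> carrier ?S" if "x \<in> carrier G" for x
      using that bij' by (rule bij_betw_apply[rotated])
    fix x y assume xy: "x \<in> carrier G" "y \<in> carrier G"
    have "f (?g x \<otimes>\<^bsub>?S\<^esub> ?g y) = x \<otimes>\<^bsub>G\<^esub> y"
      using xy in_S by (simp add: hom_mult[OF f] bij_betw_inv_into_right[OF bij])
    then show "?g (x \<otimes>\<^bsub>G\<^esub> y) = ?g x \<otimes>\<^bsub>?S\<^esub> ?g y"
      using bij_betw_inv_into_left[OF bij closed[OF in_S in_S]] xy by metis
  qed
qed

end

section \<open>The group of the maps \<open>theta\<close>\<close>

lemma one_in_characters: "(\<lambda>x. 1) \<in> characters"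
  by (simp add: characters_def)

lemma characters_mult: "\<chi> \<in> characters \<Longrightarrow> \<psi> \<in> characters \<Longrightarrow> (\<lambda>x. \<chi> x * \<psi> x) \<in> characters"
  by (simp add: characters_def)

lemma characters_inverse: "\<chi> \<in> characters \<Longrightarrow> (\<lambda>x. inverse (\<chi> x)) \<in> characters"
  by (simp add: characters_def)

lemma group_character_group: "group character_group"
proof (rule groupI)
  fix \<chi> :: "'a \<Rightarrow> 'b" assume "\<chi> \<in> carrier character_group"
  then show "\<exists>\<psi>\<in>carrier character_group. \<psi> \<otimes>\<^bsub>character_group\<^esub> \<chi> = \<one>\<^bsub>character_group\<^esub>"
    by (intro bexI[of _ "\<lambda>x. inverse (\<chi> x)"])
      (auto simp: character_group_def characters_inverse, simp add: characters_def)
qed (auto simp: character_group_def one_in_characters characters_mult mult.assoc)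

lemma one_in_scalings: "1 \<in> scalings d"
  by (simp add: scalings_def)

lemma scalings_nonzero: "\<epsilon> \<in> scalings d \<Longrightarrow> \<epsilon> \<noteq> 0"
  by (simp add: scalings_def)

context
  fixes d :: "'a::ab_group_add \<Rightarrow> 'f::field_char_0"
  assumes additive: "\<And>x y. d (x + y) = d x + d y"
    and nondegenerate: "\<And>x. x \<noteq> 0 \<Longrightarrow> d x \<noteq> 0"
begin

text \<open>Resolving with \<open>nondegenerate\<close> leaves the premise \<open>\<And>x. x \<noteq> 0 \<Longrightarrow> x \<noteq> 0\<close> behind.\<close>

lemmas trivial_premise =
  not_False_eq_True implies_True_equals triv_forall_equality True_implies_equals

lemmas
  group_scale = group_scale[of d, OF additive nondegenerate, simplified trivial_premise]
  and group_scale_1 = group_scale_1[of d, OF additive nondegenerate, simplified trivial_premise]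
  and group_scale_add = group_scale_add[of d, OF additive nondegenerate, simplified trivial_premise]
  and group_scale_group_scale =
    group_scale_group_scale[of d, OF additive nondegenerate, simplified trivial_premise]
  and scalings_inverse = scalings_inverse[of d, OF additive nondegenerate, simplified trivial_premise]
  and scalings_mult = scalings_mult[of d, OF additive nondegenerate, simplified trivial_premise]
  and theta_1 = theta_1[of d, OF additive nondegenerate, simplified trivial_premise]
  and theta_comp = theta_comp[of d, OF additive nondegenerate, simplified trivial_premise]
  and theta_td = theta_td[of d, OF additive nondegenerate, simplified trivial_premise]

lemma group_scaling_group: "group (scaling_group d)"
proof (rule groupI)
  fix \<epsilon> assume "\<epsilon> \<in> carrier (scaling_group d)"
  then show "\<exists>\<delta>\<in>carrier (scaling_group d). \<delta> \<otimes>\<^bsub>scaling_group d\<^esub> \<epsilon> = \<one>\<^bsub>scaling_group d\<^esub>"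
    by (intro bexI[of _ "inverse \<epsilon>"])
      (auto simp: scaling_group_def scalings_inverse scalings_nonzero)
qed (auto simp: scaling_group_def one_in_scalings scalings_mult)

lemma characters_group_scale:
  assumes "\<chi> \<in> characters" "\<epsilon> \<in> scalings d"
  shows "(\<lambda>x. \<chi> (group_scale d \<epsilon> x)) \<in> characters"
  using assms by (simp add: characters_def group_scale_add)

text \<open>Compare the coefficients at \<open>TD (group_scale d \<epsilon> x)\<close> in the images
  of \<open>vTD x\<close>. On the left it is \<open>inverse \<epsilon> * \<chi> x\<close>, which is
  nonzero, so the right side must be supported at the same basis vector; hence \<epsilon> and
  \<epsilon>' move every \<open>x\<close> to the same element. Applying \<open>d\<close> at a
  nonzero \<open>x\<close> gives \<epsilon> = \<epsilon>', and the equality of coefficients then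
  gives \<chi> = \<chi>'.\<close>

lemma theta_inject:
  assumes ex: "\<exists>x::'a. x \<noteq> 0"
    and \<chi>: "\<chi> \<in> characters" "\<chi>' \<in> characters"
    and \<epsilon>: "\<epsilon> \<in> scalings d" "\<epsilon>' \<in> scalings d"
    and eq: "theta d \<chi> \<epsilon> a b c = theta d \<chi>' \<epsilon>' a' b' c'"
  shows "\<chi> = \<chi>'" and "\<epsilon> = \<epsilon>'"
proof -
  have nz: "\<chi> x \<noteq> 0" "\<chi>' x \<noteq> 0" "\<epsilon> \<noteq> 0" "\<epsilon>' \<noteq> 0" for x
    using \<chi> \<epsilon> by (auto simp: characters_def scalings_def)
  have coeff: "inverse \<epsilon> * \<chi> x =
    (if group_scale d \<epsilon>' x = group_scale d \<epsilon> x then inverse \<epsilon>' * \<chi>' x else 0)" for x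
  proof -
    have "Poly_Mapping.lookup (theta d \<chi> \<epsilon> a b c (vTD x)) (TD (group_scale d \<epsilon> x)) =
      Poly_Mapping.lookup (theta d \<chi>' \<epsilon>' a' b' c' (vTD x)) (TD (group_scale d \<epsilon> x))"
      using eq by simp
    then show ?thesis
      unfolding theta_td
      by (simp add: lookup_add vTD_def vT_def lookup_single "when_def")
  qed
  then have gs: "group_scale d \<epsilon>' x = group_scale d \<epsilon> x" for x
    using nz by (metis mult_eq_0_iff inverse_nonzero_iff_nonzero)
  obtain x :: 'a where "x \<noteq> 0" using ex by blast
  then show "\<epsilon> = \<epsilon>'"
    using gs[of x] group_scale[OF \<epsilon>(1), of x] group_scale[OF \<epsilon>(2), of x]
      nondegenerate[of x] by simp
  then show "\<chi> = \<chi>'" using coeff nz by (intro ext) simp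
qed

section \<open>The group structure on the maps \<open>theta\<close>\<close>

lemma theta_in_carrier [simp]:
  "\<chi> \<in> characters \<Longrightarrow> \<epsilon> \<in> scalings d \<Longrightarrow> c \<noteq> 0 \<Longrightarrow> theta d \<chi> \<epsilon> a b c \<in> carrier (aut_D1 d)"
  unfolding aut_D1_def by force

lemma aut_D1_carrierE:
  assumes "f \<in> carrier (aut_D1 d)"
  obtains \<chi> \<epsilon> a b c where "f = theta d \<chi> \<epsilon> a b c" "\<chi> \<in> characters" "\<epsilon> \<in> scalings d" "c \<noteq> 0"
  using assms by (auto simp: aut_D1_def)

lemma aut_D1_mult: "f \<otimes>\<^bsub>aut_D1 d\<^esub> g = f \<circ> g"
  and aut_D1_one: "\<one>\<^bsub>aut_D1 d\<^esub> = id"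
  by (simp_all add: aut_D1_def)

lemma theta_mult:
  assumes "\<epsilon> \<in> scalings d" "\<epsilon>' \<in> scalings d"
  shows "theta d \<chi> \<epsilon> a b c \<otimes>\<^bsub>aut_D1 d\<^esub> theta d \<chi>' \<epsilon>' a' b' c' =
    theta d (\<lambda>x. \<chi>' x * \<chi> (group_scale d \<epsilon>' x)) (\<epsilon> * \<epsilon>')
      (inverse \<epsilon>' * a + c * a') (b + c * b') (c * c')"
  by (simp add: aut_D1_mult theta_comp[OF assms])

text \<open>The parameters solve the composition rule for the trivial tuple:
  \<open>c' * c = 1\<close>, \<open>b' + c' * b = 0\<close>,
  \<open>inverse \<epsilon> * a' + c' * a = 0\<close>, and \<chi>'(\<epsilon>x) \<chi>(x) = 1, which
  is why \<chi> is evaluated at the element scaled by \<open>inverse \<epsilon>\<close>.\<close>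

lemma theta_left_inverse:
  assumes "\<chi> \<in> characters" "\<epsilon> \<in> scalings d" "c \<noteq> 0"
  shows "theta d (\<lambda>x. inverse (\<chi> (group_scale d (inverse \<epsilon>) x))) (inverse \<epsilon>)
    (- (\<epsilon> * a / c)) (- (b / c)) (1 / c) \<otimes>\<^bsub>aut_D1 d\<^esub> theta d \<chi> \<epsilon> a b c = \<one>\<^bsub>aut_D1 d\<^esub>"
  \<comment> \<open>Reversing \<open>theta_1\<close> writes the identity as a \<open>theta\<close>
    as well, so that the two sides can be compared parameter by parameter.\<close>
  using assms scalings_nonzero[OF assms(2)]
  by (simp add: theta_mult scalings_inverse aut_D1_one theta_1[symmetric]
      group_scale_group_scale group_scale_1)
    (simp add: characters_def mult.assoc[symmetric])

lemma theta_inverse_in_carrier: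
  assumes "\<chi> \<in> characters" "\<epsilon> \<in> scalings d" "c \<noteq> 0"
  shows "theta d (\<lambda>x. inverse (\<chi> (group_scale d (inverse \<epsilon>) x))) (inverse \<epsilon>)
    (- (\<epsilon> * a / c)) (- (b / c)) (1 / c) \<in> carrier (aut_D1 d)"
  using assms
  by (simp add: characters_inverse characters_group_scale scalings_inverse)

lemma group_aut_D1: "group (aut_D1 d)"
proof (rule groupI)
  fix f g assume "f \<in> carrier (aut_D1 d)" "g \<in> carrier (aut_D1 d)"
  then show "f \<otimes>\<^bsub>aut_D1 d\<^esub> g \<in> carrier (aut_D1 d)"
    by (elim aut_D1_carrierE)
      (simp add: theta_mult characters_mult characters_group_scale scalings_mult)
next
  fix f assume "f \<in> carrier (aut_D1 d)"
  then show "\<exists>g\<in>carrier (aut_D1 d). g \<otimes>\<^bsub>aut_D1 d\<^esub> f = \<one>\<^bsub>aut_D1 d\<^esub>"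
    by (elim aut_D1_carrierE) (use theta_left_inverse theta_inverse_in_carrier in blast)
next
  show "\<one>\<^bsub>aut_D1 d\<^esub> \<in> carrier (aut_D1 d)"
    using theta_in_carrier[OF one_in_characters one_in_scalings, of 1 0 0]
    by (simp add: aut_D1_one theta_1)
qed (auto simp: aut_D1_mult aut_D1_one)

interpretation aut: group "aut_D1 d" by (rule group_aut_D1)

lemma inv_theta:
  assumes "\<chi> \<in> characters" "\<epsilon> \<in> scalings d" "c \<noteq> 0"
  shows "inv\<^bsub>aut_D1 d\<^esub> theta d \<chi> \<epsilon> a b c =
    theta d (\<lambda>x. inverse (\<chi> (group_scale d (inverse \<epsilon>) x))) (inverse \<epsilon>)
      (- (\<epsilon> * a / c)) (- (b / c)) (1 / c)"
  using assms by (intro aut.inv_equality theta_left_inverse theta_inverse_in_carrier) auto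

section \<open>The distinguished subgroups and the normality of X(A)\<aa>\<cc>\<close>

lemma subgroup_Xac_eq: "subgroup_Xac d = {theta d \<chi> 1 a b c | \<chi> a b c. \<chi> \<in> characters \<and> c \<noteq> 0}"
proof -
  \<comment> \<open>In this order every left factor has last entry 1, so the composition rule leaves
    \<open>a\<close> and \<open>b\<close> unscaled. The product set is therefore exactly the set of
    all \<open>theta\<close> with \<epsilon> = 1, the kernel of \<theta> \<mapsto>
    \<epsilon>.\<close>
  have *: "theta d \<chi> 1 0 0 1 \<otimes>\<^bsub>aut_D1 d\<^esub> theta d (\<lambda>x. 1) 1 a b 1
      \<otimes>\<^bsub>aut_D1 d\<^esub> theta d (\<lambda>x. 1) 1 0 0 c = theta d \<chi> 1 a b c" for \<chi> a b c
    by (simp add: theta_mult one_in_scalings group_scale_1)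
  have "theta d \<chi> 1 a b c \<in> subgroup_Xac d" if "\<chi> \<in> characters" "c \<noteq> 0" for \<chi> a b c
    unfolding subgroup_Xac_def set_mult_def subgroup_X_def subgroup_a_def subgroup_c_def
    using that by (subst *[symmetric]) blast
  moreover have "subgroup_Xac d \<subseteq> {theta d \<chi> 1 a b c | \<chi> a b c. \<chi> \<in> characters \<and> c \<noteq> 0}"
    unfolding subgroup_Xac_def set_mult_def subgroup_X_def subgroup_a_def subgroup_c_def
    using * by blast
  ultimately show ?thesis by blast
qed

text \<open>All subgroups considered are cut out by a condition \<open>P\<close> on the parameters.
  The formulas for products and inverses turn the subgroup axioms into closure properties of
  \<open>P\<close>, which are then immediate for each subgroup. Each element only has to possess
  some parameter tuple satisfying \<open>P\<close>, so uniqueness of parameters does not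
  enter.\<close>

lemma theta_subgroupI:
  assumes "H = {theta d \<chi> \<epsilon> a b c | \<chi> \<epsilon> a b c. P \<chi> \<epsilon> a b c}"
    and "\<And>\<chi> \<epsilon> a b c. P \<chi> \<epsilon> a b c \<Longrightarrow> \<chi> \<in> characters \<and> \<epsilon> \<in> scalings d \<and> c \<noteq> 0"
    and "P (\<lambda>x. 1) 1 0 0 1"
    and "\<And>\<chi> \<epsilon> a b c \<chi>' \<epsilon>' a' b' c'. P \<chi> \<epsilon> a b c \<Longrightarrow> P \<chi>' \<epsilon>' a' b' c' \<Longrightarrow>
      P (\<lambda>x. \<chi>' x * \<chi> (group_scale d \<epsilon>' x)) (\<epsilon> * \<epsilon>') (inverse \<epsilon>' * a + c * a') (b + c * b') (c * c')"
    and "\<And>\<chi> \<epsilon> a b c. P \<chi> \<epsilon> a b c \<Longrightarrow>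
      P (\<lambda>x. inverse (\<chi> (group_scale d (inverse \<epsilon>) x))) (inverse \<epsilon>)
        (- (\<epsilon> * a / c)) (- (b / c)) (1 / c)"
  shows "subgroup H (aut_D1 d)"
proof (rule aut.subgroupI)
  show "H \<subseteq> carrier (aut_D1 d)" using assms(1,2) by auto
  show "H \<noteq> {}" using assms(3) unfolding assms(1) by blast
  show "inv\<^bsub>aut_D1 d\<^esub> f \<in> H" if "f \<in> H" for f
  proof -
    obtain \<chi> \<epsilon> a b c where f: "f = theta d \<chi> \<epsilon> a b c" and P: "P \<chi> \<epsilon> a b c"
      using \<open>f \<in> H\<close> assms(1) by auto
    show ?thesis
      using assms(2)[OF P] assms(5)[OF P] unfolding f assms(1)
      by (force simp: inv_theta)
  qed
  show "f \<otimes>\<^bsub>aut_D1 d\<^esub> g \<in> H" if "f \<in> H" "g \<in> H" for f g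
  proof -
    obtain \<chi> \<epsilon> a b c where f: "f = theta d \<chi> \<epsilon> a b c" and P: "P \<chi> \<epsilon> a b c"
      using \<open>f \<in> H\<close> assms(1) by auto
    obtain \<chi>' \<epsilon>' a' b' c' where g: "g = theta d \<chi>' \<epsilon>' a' b' c'" and P': "P \<chi>' \<epsilon>' a' b' c'"
      using \<open>g \<in> H\<close> assms(1) by auto
    show ?thesis
      using assms(2)[OF P] assms(2)[OF P'] assms(4)[OF P P'] unfolding f g assms(1)
      by (simp only: theta_mult mem_Collect_eq) blast
  qed
qed

lemma subgroup_subgroup_X: "subgroup (subgroup_X d) (aut_D1 d)"
  by (rule theta_subgroupI[where P = "\<lambda>\<chi> \<epsilon> a b c. \<chi> \<in> characters \<and> \<epsilon> = 1 \<and> a = 0 \<and> b = 0 \<and> c = 1"])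
    (auto simp: subgroup_X_def one_in_characters one_in_scalings group_scale_1
      characters_mult characters_inverse)

lemma subgroup_subgroup_a: "subgroup (subgroup_a d) (aut_D1 d)"
  by (rule theta_subgroupI[where P = "\<lambda>\<chi> \<epsilon> a b c. \<chi> = (\<lambda>x. 1) \<and> \<epsilon> = 1 \<and> c = 1"])
    (auto simp: subgroup_a_def one_in_characters one_in_scalings)

lemma subgroup_subgroup_c: "subgroup (subgroup_c d) (aut_D1 d)"
  by (rule theta_subgroupI[where
        P = "\<lambda>\<chi> \<epsilon> a b c. \<chi> = (\<lambda>x. 1) \<and> \<epsilon> = 1 \<and> a = 0 \<and> b = 0 \<and> c \<noteq> 0"])
    (auto simp: subgroup_c_def one_in_characters one_in_scalings)

lemma subgroup_subgroup_E: "subgroup (subgroup_E d) (aut_D1 d)"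
  by (rule theta_subgroupI[where
        P = "\<lambda>\<chi> \<epsilon> a b c. \<chi> = (\<lambda>x. 1) \<and> \<epsilon> \<in> scalings d \<and> a = 0 \<and> b = 0 \<and> c = 1"])
    (auto simp: subgroup_E_def one_in_characters one_in_scalings scalings_mult
      scalings_inverse)

lemma subgroup_subgroup_Xac: "subgroup (subgroup_Xac d) (aut_D1 d)"
  by (rule theta_subgroupI[where P = "\<lambda>\<chi> \<epsilon> a b c. \<chi> \<in> characters \<and> \<epsilon> = 1 \<and> c \<noteq> 0"])
    (auto simp: subgroup_Xac_eq one_in_characters one_in_scalings group_scale_1
      characters_mult characters_inverse)

text \<open>The \<epsilon>-entry of a conjugate is \<epsilon> \<cdot> 1 \<cdot> \<epsilon>\<inverse>
  = 1, and \<epsilon> = 1 characterizes the subgroup. The explicit conjugate is computed so that its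
  character and its last entry can be seen to be admissible.\<close>

lemma normal_subgroup_Xac: "subgroup_Xac d \<lhd> aut_D1 d"
  unfolding aut.normal_inv_iff
proof (intro conjI ballI subgroup_subgroup_Xac)
  fix f n assume "f \<in> carrier (aut_D1 d)" "n \<in> subgroup_Xac d"
  then obtain \<chi> \<epsilon> a b c \<psi> a' b' c' where f: "f = theta d \<chi> \<epsilon> a b c" "\<chi> \<in> characters"
      "\<epsilon> \<in> scalings d" "c \<noteq> 0" and n: "n = theta d \<psi> 1 a' b' c'" "\<psi> \<in> characters" "c' \<noteq> 0"
    by (auto simp: subgroup_Xac_eq elim!: aut_D1_carrierE)
  obtain \<chi>'' a'' b'' where "f \<otimes>\<^bsub>aut_D1 d\<^esub> n \<otimes>\<^bsub>aut_D1 d\<^esub> inv\<^bsub>aut_D1 d\<^esub> f = theta d \<chi>'' 1 a'' b'' c'"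
    and "\<chi>'' \<in> characters"
  proof
    \<comment> \<open>Two applications of the composition rule give these entries. The character
      equals \<psi>(\<epsilon>\<inverse>x); it is left uncancelled, and closure of the characters
      under products, inverses and scaling of the argument covers it in this form.\<close>
    show "f \<otimes>\<^bsub>aut_D1 d\<^esub> n \<otimes>\<^bsub>aut_D1 d\<^esub> inv\<^bsub>aut_D1 d\<^esub> f =
      theta d (\<lambda>x. inverse (\<chi> (group_scale d (inverse \<epsilon>) x)) *
        (\<psi> (group_scale d (inverse \<epsilon>) x) * \<chi> (group_scale d (inverse \<epsilon>) x))) 1
        (\<epsilon> * (a + c * a') - c' * \<epsilon> * a) (b + c * b' - c' * b) c'"
      using f n scalings_nonzero[OF f(3)]
      by (simp add: inv_theta theta_mult one_in_scalings scalings_inverse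
          scalings_mult group_scale_1 algebra_simps)
  qed (intro characters_mult characters_inverse characters_group_scale[of _ "inverse \<epsilon>"]
        f n scalings_inverse)
  then show "f \<otimes>\<^bsub>aut_D1 d\<^esub> n \<otimes>\<^bsub>aut_D1 d\<^esub> inv\<^bsub>aut_D1 d\<^esub> f \<in> subgroup_Xac d"
    using n by (auto simp: subgroup_Xac_eq)
qed

section \<open>The embeddings of X(A) and \<E>, and the splitting\<close>

lemma theta_character_iso:
  assumes "\<exists>x::'a. x \<noteq> 0"
  shows "(\<lambda>\<chi>. theta d \<chi> 1 0 0 1) \<in> iso character_group ((aut_D1 d)\<lparr>carrier := subgroup_X d\<rparr>)"
proof (rule isoI)
  show "(\<lambda>\<chi>. theta d \<chi> 1 0 0 1) \<in> hom character_group ((aut_D1 d)\<lparr>carrier := subgroup_X d\<rparr>)"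
    by (rule homI)
      (auto simp: character_group_def subgroup_X_def theta_mult one_in_scalings
        group_scale_1 mult.commute)
  show "bij_betw (\<lambda>\<chi>. theta d \<chi> 1 0 0 1) (carrier character_group)
      (carrier ((aut_D1 d)\<lparr>carrier := subgroup_X d\<rparr>))"
    unfolding bij_betw_def character_group_def subgroup_X_def
    by (auto intro!: inj_onI theta_inject(1)[OF assms _ _ one_in_scalings one_in_scalings])
qed

text \<open>This is the section of \<theta> \<mapsto> \<epsilon>: the trivial character is
  unaffected by scaling its argument, and a = b = 0, c = 1 persist under composition. The target is
  the whole group, as the general lemmas on semidirect products require.\<close>

lemma theta_scaling_hom: "(\<lambda>\<epsilon>. theta d (\<lambda>x. 1) \<epsilon> 0 0 1) \<in> hom (scaling_group d) (aut_D1 d)"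
  by (rule homI) (auto simp: scaling_group_def theta_mult one_in_characters)

lemma theta_scaling_iso:
  assumes "\<exists>x::'a. x \<noteq> 0"
  shows "(\<lambda>\<epsilon>. theta d (\<lambda>x. 1) \<epsilon> 0 0 1)
    \<in> iso (scaling_group d) ((aut_D1 d)\<lparr>carrier := subgroup_E d\<rparr>)"
proof (rule isoI)
  show "(\<lambda>\<epsilon>. theta d (\<lambda>x. 1) \<epsilon> 0 0 1)
    \<in> hom (scaling_group d) ((aut_D1 d)\<lparr>carrier := subgroup_E d\<rparr>)"
    by (rule homI) (auto simp: scaling_group_def subgroup_E_def theta_mult)
  show "bij_betw (\<lambda>\<epsilon>. theta d (\<lambda>x. 1) \<epsilon> 0 0 1) (carrier (scaling_group d))
      (carrier ((aut_D1 d)\<lparr>carrier := subgroup_E d\<rparr>))"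
    unfolding bij_betw_def scaling_group_def subgroup_E_def
    by (auto intro!: inj_onI theta_inject(2)[OF assms one_in_characters one_in_characters])
qed

text \<open>Every element factors uniquely as \<open>n\<close> times a pure scaling. The product
  determines \<epsilon> by \<open>theta_inject\<close>, and cancelling the scaling on the right then
  determines \<open>n\<close>; surjectivity comes from solving the product formula for
  \<open>n\<close>.\<close>

lemma Xac_scaling_bij:
  assumes ex: "\<exists>x::'a. x \<noteq> 0"
  shows "bij_betw (\<lambda>(n, \<epsilon>). n \<otimes>\<^bsub>aut_D1 d\<^esub> theta d (\<lambda>x. 1) \<epsilon> 0 0 1)
    (subgroup_Xac d \<times> scalings d) (carrier (aut_D1 d))"
proof (rule bij_betw_imageI)
  let ?s = "\<lambda>\<epsilon>. theta d (\<lambda>x. 1) \<epsilon> 0 0 1"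
  have prod: "theta d \<chi> 1 a b c \<otimes>\<^bsub>aut_D1 d\<^esub> ?s \<epsilon> =
    theta d (\<lambda>x. \<chi> (group_scale d \<epsilon> x)) \<epsilon> (a / \<epsilon>) b c" if "\<epsilon> \<in> scalings d" for \<chi> a b c \<epsilon>
    using that by (simp add: theta_mult one_in_scalings divide_inverse_commute)
  have s: "?s \<epsilon> \<in> carrier (aut_D1 d)" if "\<epsilon> \<in> scalings d" for \<epsilon>
    using that by (simp add: one_in_characters)
  show "inj_on (\<lambda>(n, \<epsilon>). n \<otimes>\<^bsub>aut_D1 d\<^esub> ?s \<epsilon>) (subgroup_Xac d \<times> scalings d)"
  proof (rule inj_onI, clarify)
    fix n \<epsilon> n' \<epsilon>'
    assume n: "n \<in> subgroup_Xac d" "n' \<in> subgroup_Xac d"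
      and \<epsilon>: "\<epsilon> \<in> scalings d" "\<epsilon>' \<in> scalings d"
      and eq: "n \<otimes>\<^bsub>aut_D1 d\<^esub> ?s \<epsilon> = n' \<otimes>\<^bsub>aut_D1 d\<^esub> ?s \<epsilon>'"
    obtain \<chi> a b c \<chi>' a' b' c' where th: "n = theta d \<chi> 1 a b c" "\<chi> \<in> characters"
        "n' = theta d \<chi>' 1 a' b' c'" "\<chi>' \<in> characters"
      using n by (auto simp: subgroup_Xac_eq)
    have "\<epsilon> = \<epsilon>'"
      by (rule theta_inject(2)[OF ex _ _ \<epsilon>])
        (use eq th \<epsilon> in \<open>auto simp: prod intro: characters_group_scale\<close>)
    moreover have "n \<in> carrier (aut_D1 d)" "n' \<in> carrier (aut_D1 d)"
      using n subgroup.mem_carrier[OF subgroup_subgroup_Xac] by auto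
    ultimately show "n = n' \<and> \<epsilon> = \<epsilon>'" using eq s[OF \<epsilon>(2)] by simp
  qed
  show "(\<lambda>(n, \<epsilon>). n \<otimes>\<^bsub>aut_D1 d\<^esub> ?s \<epsilon>) ` (subgroup_Xac d \<times> scalings d) = carrier (aut_D1 d)"
  proof (intro equalityI subsetI)
    fix f assume "f \<in> carrier (aut_D1 d)"
    then obtain \<chi> \<epsilon> a b c where f: "f = theta d \<chi> \<epsilon> a b c" "\<chi> \<in> characters" "\<epsilon> \<in> scalings d" "c \<noteq> 0"
      by (rule aut_D1_carrierE)
    \<comment> \<open>By \<open>prod\<close>, multiplying by the scaling on the right replaces
      \<chi>(x) by \<chi>(\<epsilon>x) and \<open>a\<close> by \<open>a / \<epsilon>\<close>; the
      entries chosen here undo both changes.\<close>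
    let ?n = "theta d (\<lambda>x. \<chi> (group_scale d (inverse \<epsilon>) x)) 1 (\<epsilon> * a) b c"
    have "?n \<in> subgroup_Xac d"
      using f characters_group_scale[OF f(2) scalings_inverse[OF f(3)]]
      by (auto simp: subgroup_Xac_eq)
    moreover have "f = ?n \<otimes>\<^bsub>aut_D1 d\<^esub> ?s \<epsilon>"
      using f scalings_nonzero[OF f(3)]
      by (simp add: prod group_scale_group_scale scalings_inverse group_scale_1)
    ultimately show "f \<in> (\<lambda>(n, \<epsilon>). n \<otimes>\<^bsub>aut_D1 d\<^esub> ?s \<epsilon>) ` (subgroup_Xac d \<times> scalings d)"
      using f(3) by force
  qed (use s subgroup.mem_carrier[OF subgroup_subgroup_Xac] in auto)
qed

text \<open>These are the three assumptions of the general lemmas on split extensions, in the order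
  in which they have to be discharged.\<close>

lemmas aut_D1_split = normal_subgroup_Xac group_scaling_group theta_scaling_hom

lemma Xac_scaling_iso:
  assumes "\<exists>x::'a. x \<noteq> 0"
  shows "(\<lambda>(n, \<epsilon>). n \<otimes>\<^bsub>aut_D1 d\<^esub> theta d (\<lambda>x. 1) \<epsilon> 0 0 1)
    \<in> iso (semidirect_product ((aut_D1 d)\<lparr>carrier := subgroup_Xac d\<rparr>) (scaling_group d)
      (\<lambda>\<epsilon>. conjugation_action (aut_D1 d) (subgroup_Xac d) (theta d (\<lambda>x. 1) \<epsilon> 0 0 1))) (aut_D1 d)"
proof (rule isoI)
  show "bij_betw (\<lambda>(n, \<epsilon>). n \<otimes>\<^bsub>aut_D1 d\<^esub> theta d (\<lambda>x. 1) \<epsilon> 0 0 1)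
    (carrier (semidirect_product ((aut_D1 d)\<lparr>carrier := subgroup_Xac d\<rparr>) (scaling_group d)
      (\<lambda>\<epsilon>. conjugation_action (aut_D1 d) (subgroup_Xac d) (theta d (\<lambda>x. 1) \<epsilon> 0 0 1))))
    (carrier (aut_D1 d))"
    using Xac_scaling_bij[OF assms] by (simp add: semidirect_product_def scaling_group_def)
qed (rule semidirect_product_mult_hom[OF aut_D1_split])

lemmas Xac_scaling_action_hom = conjugation_action_hom[OF aut_D1_split]

lemmas Xac_scaling_iso_sym = semidirect_product_iso_sym[OF aut_D1_split Xac_scaling_iso]

end

text \<open>The abstract isomorphism alone would not say how the factors sit inside the group. The
  conclusion therefore also records the embeddings of X(A) and \<E>, the normality of
  X(A)\<aa>\<cc>, that \<alpha> really is an action by automorphisms, and that the isomorphism is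
  multiplication inside the group.\<close>

theorem theorem5p5:
  fixes d :: "'a::ab_group_add \<Rightarrow> 'f::field_char_0"
  assumes "\<exists>x::'a. x \<noteq> 0"
    and "\<And>x y. d (x + y) = d x + d y"
    and "\<And>x. x \<noteq> 0 \<Longrightarrow> d x \<noteq> 0"
  defines "G \<equiv> aut_D1 d"
    and "N \<equiv> (aut_D1 d)\<lparr>carrier := subgroup_Xac d\<rparr>"
    and "E \<equiv> scaling_group d"
    and "\<alpha> \<equiv> (\<lambda>\<epsilon>. conjugation_action (aut_D1 d) (subgroup_Xac d) (theta d (\<lambda>x. 1) \<epsilon> 0 0 1))"
  shows "group G \<and> group (character_group :: ('a \<Rightarrow> 'f) monoid) \<and> group E
    \<and> subgroup (subgroup_X d) G \<and> subgroup (subgroup_a d) G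
    \<and> subgroup (subgroup_c d) G \<and> subgroup (subgroup_E d) G
    \<and> (\<lambda>\<chi>. theta d \<chi> 1 0 0 1) \<in> iso character_group (G\<lparr>carrier := subgroup_X d\<rparr>)
    \<and> (\<lambda>\<epsilon>. theta d (\<lambda>x. 1) \<epsilon> 0 0 1) \<in> iso E (G\<lparr>carrier := subgroup_E d\<rparr>)
    \<and> subgroup_Xac d \<lhd> G
    \<and> \<alpha> \<in> hom E (AutoGroup N)
    \<and> (\<lambda>(n, \<epsilon>). n \<otimes>\<^bsub>G\<^esub> theta d (\<lambda>x. 1) \<epsilon> 0 0 1) \<in> iso (semidirect_product N E \<alpha>) G
    \<and> G \<cong> semidirect_product N E \<alpha>"
  unfolding G_def N_def E_def \<alpha>_def
  by (intro conjI group_aut_D1 group_character_group group_scaling_group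
      subgroup_subgroup_X subgroup_subgroup_a subgroup_subgroup_c subgroup_subgroup_E
      theta_character_iso theta_scaling_iso normal_subgroup_Xac
      Xac_scaling_action_hom Xac_scaling_iso Xac_scaling_iso_sym assms(1-3))

end
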